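(* Let $h_1\neq h_2$ be real numbers, let $a_1,a_2\in\mathbb R$ and $T_1,T_2,c_1,c_2>0$, and suppose that $$\mu=c_1\left(\mathcal L\!\restriction_{[a_1,a_1+T_1]}\times\delta_{h_1}\right)+c_2\left(\mathcal L\!\restriction_{[a_2,a_2+T_2]}\times\delta_{h_2}\right)$$ is a Borel probability measure on $\mathbb R^2$. Then $\mu$ is a spectral measure if and only if $$c_1=c_2=\frac{1}{T_1+T_2}.$$
   Context: $\mathcal L$ is one-dimensional Lebesgue measure, $\mathcal L\!\restriction_{E}$ its restriction to $E$, $\delta_h$ the Dirac mass at $h\in\mathbb R$, and $\times$ denotes the product measure on $\mathbb R\times\mathbb R$. A Borel probability measure $\mu$ on $\mathbb R^d$ is called a spectral measure if there is a countable set $\Lambda\subset\mathbb R^d$ (called a spectrum of $\mu$) such that $\{e^{2\pi i\langle\lambda,x\rangle}\}_{\lambda\in\Lambda}$ is an orthonormal basis of $L^2(\mu)$. *)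

theory Defs
  imports "HOL-Probability.Probability"
begin

text \<open>The second argument is expected to live on the same \<open>\<sigma>\<close>-algebra as the first one.\<close>

definition add_measure :: "'a measure \<Rightarrow> 'a measure \<Rightarrow> 'a measure" where
  "add_measure M N = measure_of (space M) (sets M) (\<lambda>A. emeasure M A + emeasure N A)"

lemma space_add_measure [simp]: "space (add_measure M N) = space M"
  by (simp add: add_measure_def)

lemma sets_add_measure [simp, measurable_cong]: "sets (add_measure M N) = sets M"
  by (simp add: add_measure_def)

lemma emeasure_add_measure:
  assumes "sets N = sets M" and "A \<in> sets M"
  shows "emeasure (add_measure M N) A = emeasure M A + emeasure N A"
proof -
  have "countably_additive (sets M) (\<lambda>A. emeasure M A + emeasure N A)"
    using assms(1)
    by (auto intro!: countably_additiveI simp: suminf_add[symmetric] suminf_emeasure)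
  then show ?thesis
    unfolding add_measure_def
    by (intro emeasure_measure_of_sigma) (auto simp: positive_def assms(2) sets.sigma_algebra_axioms)
qed

text \<open>
  Square-integrable functions are not identified up to null sets here: elements of the
  Hilbert space \<open>L\<^sup>2(M)\<close> are given by representatives, and all notions below only depend on
  the class of a function modulo equality almost everywhere.
\<close>

definition square_integrable :: "'a measure \<Rightarrow> ('a \<Rightarrow> complex) \<Rightarrow> bool" where
  "square_integrable M f \<longleftrightarrow> f \<in> borel_measurable M \<and> integrable M (\<lambda>x. (cmod (f x))\<^sup>2)"

definition L2_inner :: "'a measure \<Rightarrow> ('a \<Rightarrow> complex) \<Rightarrow> ('a \<Rightarrow> complex) \<Rightarrow> complex" where
  "L2_inner M f g = (LINT x|M. f x * cnj (g x))"

definition L2_norm :: "'a measure \<Rightarrow> ('a \<Rightarrow> complex) \<Rightarrow> real" where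
  "L2_norm M f = sqrt (LINT x|M. (cmod (f x))\<^sup>2)"

text \<open>
  An orthonormal basis is an orthonormal family whose linear span is dense. The orthonormality
  is that of an indexed family, so distinct indices give orthogonal members.
\<close>

definition L2_orthonormal_basis :: "'a measure \<Rightarrow> 'i set \<Rightarrow> ('i \<Rightarrow> 'a \<Rightarrow> complex) \<Rightarrow> bool" where
  "L2_orthonormal_basis M I e \<longleftrightarrow>
     (\<forall>i\<in>I. square_integrable M (e i)) \<and>
     (\<forall>i\<in>I. \<forall>j\<in>I. L2_inner M (e i) (e j) = (if i = j then 1 else 0)) \<and>
     (\<forall>f. square_integrable M f \<longrightarrow>
        (\<forall>\<epsilon>>0. \<exists>F c. finite F \<and> F \<subseteq> I \<and>
           L2_norm M (\<lambda>x. f x - (\<Sum>i\<in>F. c i * e i x)) < \<epsilon>))"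

definition exponential :: "'a::euclidean_space \<Rightarrow> 'a \<Rightarrow> complex" where
  "exponential \<xi> x = exp (2 * complex_of_real pi * \<i> * complex_of_real (\<xi> \<bullet> x))"

definition is_spectrum :: "'a::euclidean_space measure \<Rightarrow> 'a set \<Rightarrow> bool" where
  "is_spectrum M \<Lambda> \<longleftrightarrow> countable \<Lambda> \<and> L2_orthonormal_basis M \<Lambda> exponential"

definition spectral_measure :: "'a::euclidean_space measure \<Rightarrow> bool" where
  "spectral_measure M \<longleftrightarrow>
     sets M = sets borel \<and> prob_space M \<and> (\<exists>\<Lambda>. is_spectrum M \<Lambda>)"

text \<open>
  Unlike \<^const>\<open>restrict_space\<close>, which shrinks the underlying space, this is the measure
  \<open>A \<mapsto> \<L>(A \<inter> E)\<close> on the Borel sets of the whole line.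
\<close>

definition lebesgue_restr :: "real set \<Rightarrow> real measure" where
  "lebesgue_restr E = density lborel (indicator E)"

lemma emeasure_lebesgue_restr:
  assumes "E \<in> sets borel" and "A \<in> sets borel"
  shows "emeasure (lebesgue_restr E) A = emeasure lborel (A \<inter> E)"
proof -
  have "emeasure (lebesgue_restr E) A = (\<integral>\<^sup>+x. indicator E x * indicator A x \<partial>lborel)"
    using assms by (simp add: lebesgue_restr_def emeasure_density)
  also have "\<dots> = (\<integral>\<^sup>+x. indicator (A \<inter> E) x \<partial>lborel)"
    by (intro nn_integral_cong) (simp split: split_indicator)
  finally show ?thesis using assms by simp
qed

lemma sets_lebesgue_restr_pair_return:
  fixes h :: real
  shows "sets (lebesgue_restr E \<Otimes>\<^sub>M return borel h) = sets borel"
proof -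
  have "sets (lebesgue_restr E \<Otimes>\<^sub>M return borel h) = sets ((borel :: real measure) \<Otimes>\<^sub>M (borel :: real measure))"
    by (intro sets_pair_measure_cong) (simp_all add: lebesgue_restr_def)
  then show ?thesis unfolding borel_prod .
qed

end

theory Submission
  imports Defs "HOL-Computational_Algebra.Polynomial"
begin

text \<open>
  If the measure is spectral, normalised indicator functions of pieces of equal length \<open>T\<close> of the
  two segments that correspond under translation have Fourier coefficients of equal moduli, so
  Parseval gives \<open>T / c1 = T / c2\<close>.

  Conversely, sliding the second segment horizontally so that it starts where the first one ends
  turns the measure with equal weights into the uniform one on an interval of length \<open>T1 + T2\<close>.
  The exponential of frequency \<open>n / (T1 + T2)\<close> on that interval is, up to a unimodular constant,
  the restriction of a plane wave to the two segments: the vertical frequency is chosen to undo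
  the phase shift caused by the slide. Completeness of these exponentials comes from the
  Stone-Weierstrass theorem on the circle, passing from continuous functions to indicators of
  closed sets, then of Borel sets, and then to all square-integrable functions.
\<close>

section \<open>Closed subspaces of the square-integrable functions\<close>

lemma square_integrable_measurable [measurable_dest]:
  "square_integrable M f \<Longrightarrow> f \<in> borel_measurable M"
  by (simp add: square_integrable_def)

lemma cmod_add_squared_le: "(cmod (a + b))\<^sup>2 \<le> 2 * (cmod a)\<^sup>2 + 2 * (cmod b)\<^sup>2"
proof -
  have "(cmod (a + b))\<^sup>2 \<le> (cmod a + cmod b)\<^sup>2"
    by (simp add: norm_triangle_ineq power_mono)
  also have "\<dots> \<le> 2 * (cmod a)\<^sup>2 + 2 * (cmod b)\<^sup>2"
    using zero_le_power2[of "cmod a - cmod b"] by (simp add: power2_eq_square algebra_simps)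
  finally show ?thesis .
qed

lemma square_integrable_add:
  assumes "square_integrable M f" "square_integrable M g"
  shows "square_integrable M (\<lambda>x. f x + g x)"
    and "(LINT x|M. (cmod (f x + g x))\<^sup>2) \<le> 2 * (LINT x|M. (cmod (f x))\<^sup>2) + 2 * (LINT x|M. (cmod (g x))\<^sup>2)"
proof -
  have [measurable]: "f \<in> borel_measurable M" "g \<in> borel_measurable M"
    and i: "integrable M (\<lambda>x. (cmod (f x))\<^sup>2)" "integrable M (\<lambda>x. (cmod (g x))\<^sup>2)"
    using assms by (auto simp: square_integrable_def)
  have i2: "integrable M (\<lambda>x. 2 * (cmod (f x))\<^sup>2 + 2 * (cmod (g x))\<^sup>2)"
    using i by simp
  have i3: "integrable M (\<lambda>x. (cmod (f x + g x))\<^sup>2)"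
    by (rule Bochner_Integration.integrable_bound[OF i2])
       (auto simp: cmod_add_squared_le intro!: AE_I2 order_trans[OF cmod_add_squared_le abs_ge_self])
  then show "square_integrable M (\<lambda>x. f x + g x)" by (simp add: square_integrable_def)
  have "(LINT x|M. (cmod (f x + g x))\<^sup>2) \<le> (LINT x|M. 2 * (cmod (f x))\<^sup>2 + 2 * (cmod (g x))\<^sup>2)"
    using i3 i2 by (intro integral_mono) (auto simp: cmod_add_squared_le)
  also have "\<dots> = 2 * (LINT x|M. (cmod (f x))\<^sup>2) + 2 * (LINT x|M. (cmod (g x))\<^sup>2)"
    using i by simp
  finally show "(LINT x|M. (cmod (f x + g x))\<^sup>2) \<le> 2 * (LINT x|M. (cmod (f x))\<^sup>2) + 2 * (LINT x|M. (cmod (g x))\<^sup>2)" .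
qed

lemma square_integrable_cmult:
  "square_integrable M f \<Longrightarrow> square_integrable M (\<lambda>x. c * f x)"
  by (auto simp: square_integrable_def norm_mult power_mult_distrib)

lemma square_integrable_diff:
  assumes "square_integrable M f" "square_integrable M g"
  shows "square_integrable M (\<lambda>x. f x - g x)"
  using square_integrable_add(1)[OF assms(1) square_integrable_cmult[OF assms(2), of "-1"]] by simp

lemma square_integrable_sum:
  assumes "\<And>i. i \<in> F \<Longrightarrow> square_integrable M (e i)"
  shows "square_integrable M (\<lambda>x. \<Sum>i\<in>F. c i * e i x)"
  using assms
  by (induction F rule: infinite_finite_induct)
     (auto intro!: square_integrable_add square_integrable_cmult simp: square_integrable_def[of M "\<lambda>_. 0"])

lemma (in finite_measure) square_integrable_bounded:
  assumes "f \<in> borel_measurable M" "\<And>x. x \<in> space M \<Longrightarrow> cmod (f x) \<le> B"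
  shows "square_integrable M f"
proof -
  have "integrable M (\<lambda>x. (cmod (f x))\<^sup>2)"
    using assms by (intro integrable_const_bound[where B = "B\<^sup>2"] AE_I2) (auto intro!: power_mono)
  with assms(1) show ?thesis by (simp add: square_integrable_def)
qed

lemma square_integrable_dominated_convergence:
  assumes h: "\<And>n. h n \<in> borel_measurable M" and f: "f \<in> borel_measurable M"
    and lim: "\<And>x. x \<in> space M \<Longrightarrow> (\<lambda>n. h n x) \<longlonglongrightarrow> f x"
    and bound: "\<And>n x. x \<in> space M \<Longrightarrow> cmod (h n x) \<le> G x"
    and G: "integrable M (\<lambda>x. (G x)\<^sup>2)"
  shows "square_integrable M f"
    and "(\<lambda>n. LINT x|M. (cmod (f x - h n x))\<^sup>2) \<longlonglongrightarrow> 0"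
proof -
  note [measurable] = h f
  have fb: "cmod (f x) \<le> G x" if "x \<in> space M" for x
    by (rule tendsto_upperbound[OF tendsto_norm[OF lim[OF that]]]) (auto intro!: always_eventually bound that)
  have "integrable M (\<lambda>x. (cmod (f x))\<^sup>2)"
    by (rule Bochner_Integration.integrable_bound[OF G]) (auto intro!: AE_I2 power_mono fb)
  then show "square_integrable M f" by (simp add: square_integrable_def)
  have "(\<lambda>n. LINT x|M. (cmod (f x - h n x))\<^sup>2) \<longlonglongrightarrow> (LINT x|M. 0)"
  proof (rule integral_dominated_convergence)
    show "integrable M (\<lambda>x. 4 * (G x)\<^sup>2)" using G by simp
    show "AE x in M. (\<lambda>n. (cmod (f x - h n x))\<^sup>2) \<longlonglongrightarrow> 0"
    proof (rule AE_I2)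
      fix x assume "x \<in> space M"
      from tendsto_power[OF tendsto_norm[OF tendsto_diff[OF tendsto_const lim[OF this]]], of "f x" 2]
      show "(\<lambda>n. (cmod (f x - h n x))\<^sup>2) \<longlonglongrightarrow> 0" by simp
    qed
    show "AE x in M. norm ((cmod (f x - h n x))\<^sup>2) \<le> 4 * (G x)\<^sup>2" for n
    proof (rule AE_I2)
      fix x assume x: "x \<in> space M"
      have "cmod (f x - h n x) \<le> 2 * G x"
        using norm_triangle_ineq4[of "f x" "h n x"] fb[OF x] bound[OF x, of n] by simp
      then have "(cmod (f x - h n x))\<^sup>2 \<le> (2 * G x)\<^sup>2" by (intro power_mono) auto
      then show "norm ((cmod (f x - h n x))\<^sup>2) \<le> 4 * (G x)\<^sup>2" by (simp add: power_mult_distrib)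
    qed
  qed auto
  then show "(\<lambda>n. LINT x|M. (cmod (f x - h n x))\<^sup>2) \<longlonglongrightarrow> 0" by simp
qed

section \<open>Closure of a linear subspace in mean square\<close>

text \<open>Finiteness of the measure makes constant bounds square-integrable, so that uniformly
  bounded pointwise limits, such as limits of indicators, can be handled by dominated
  convergence.\<close>

locale L2_subspace = finite_measure M for M :: "'a measure" +
  fixes S :: "('a \<Rightarrow> complex) set"
  assumes square_integrable: "g \<in> S \<Longrightarrow> square_integrable M g"
    and zero_mem: "(\<lambda>_. 0) \<in> S"
    and add_mem: "g \<in> S \<Longrightarrow> h \<in> S \<Longrightarrow> (\<lambda>x. g x + h x) \<in> S"
    and cmult_mem: "g \<in> S \<Longrightarrow> (\<lambda>x. c * g x) \<in> S"
begin

text \<open>Squared distances replace \<open>L2_norm\<close> so that no square roots occur; as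
  \<epsilon> is arbitrary, the closure is the same.\<close>

definition L2_closure :: "('a \<Rightarrow> complex) set" where
  "L2_closure = {f. square_integrable M f \<and>
     (\<forall>\<epsilon>>0. \<exists>g\<in>S. (LINT x|M. (cmod (f x - g x))\<^sup>2) < \<epsilon>)}"

lemma closure_square_integrable: "f \<in> L2_closure \<Longrightarrow> square_integrable M f"
  by (simp add: L2_closure_def)

lemma subset_closure: "f \<in> S \<Longrightarrow> f \<in> L2_closure"
  by (auto simp: L2_closure_def square_integrable intro!: bexI[of _ f])

text \<open>Closing twice gives nothing new. The bound |a + b|^2 \<le> 2 |a|^2 + 2 |b|^2 stands in
  for the triangle inequality, so each of the two errors has to stay below \<epsilon> / 4.\<close>

lemma closure_approx:
  assumes f: "square_integrable M f"
    and ap: "\<And>\<epsilon>. \<epsilon> > 0 \<Longrightarrow> \<exists>h\<in>L2_closure. (LINT x|M. (cmod (f x - h x))\<^sup>2) < \<epsilon>"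
  shows "f \<in> L2_closure"
proof -
  have "\<exists>g\<in>S. (LINT x|M. (cmod (f x - g x))\<^sup>2) < \<epsilon>" if e: "\<epsilon> > 0" for \<epsilon>
  proof -
    obtain h where h: "h \<in> L2_closure" and fh: "(LINT x|M. (cmod (f x - h x))\<^sup>2) < \<epsilon> / 4"
      using ap[of "\<epsilon> / 4"] e by auto
    obtain g where g: "g \<in> S" and hg: "(LINT x|M. (cmod (h x - g x))\<^sup>2) < \<epsilon> / 4"
      using h e unfolding L2_closure_def by (auto dest!: spec[of _ "\<epsilon> / 4"])
    have "(LINT x|M. (cmod ((f x - h x) + (h x - g x)))\<^sup>2)
        \<le> 2 * (LINT x|M. (cmod (f x - h x))\<^sup>2) + 2 * (LINT x|M. (cmod (h x - g x))\<^sup>2)"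
      by (intro square_integrable_add(2) square_integrable_diff f closure_square_integrable h square_integrable g)
    with fh hg have "(LINT x|M. (cmod (f x - g x))\<^sup>2) < \<epsilon>" by simp
    with g show ?thesis by blast
  qed
  with f show ?thesis by (simp add: L2_closure_def)
qed

lemma closure_add:
  assumes f: "f \<in> L2_closure" "f' \<in> L2_closure"
  shows "(\<lambda>x. f x + f' x) \<in> L2_closure"
proof -
  note sq = f[THEN closure_square_integrable]
  have "\<exists>g\<in>S. (LINT x|M. (cmod (f x + f' x - g x))\<^sup>2) < \<epsilon>" if e: "\<epsilon> > 0" for \<epsilon>
  proof -
    obtain g where g: "g \<in> S" and fg: "(LINT x|M. (cmod (f x - g x))\<^sup>2) < \<epsilon> / 4"
      using f(1) e unfolding L2_closure_def by (auto dest!: spec[of _ "\<epsilon> / 4"])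
    obtain g' where g': "g' \<in> S" and fg': "(LINT x|M. (cmod (f' x - g' x))\<^sup>2) < \<epsilon> / 4"
      using f(2) e unfolding L2_closure_def by (auto dest!: spec[of _ "\<epsilon> / 4"])
    have "(LINT x|M. (cmod ((f x - g x) + (f' x - g' x)))\<^sup>2)
        \<le> 2 * (LINT x|M. (cmod (f x - g x))\<^sup>2) + 2 * (LINT x|M. (cmod (f' x - g' x))\<^sup>2)"
      by (intro square_integrable_add(2) square_integrable_diff sq square_integrable g g')
    also have "\<dots> < \<epsilon>" using fg fg' by simp
    finally have "(LINT x|M. (cmod ((f x + f' x) - (g x + g' x)))\<^sup>2) < \<epsilon>" by (simp add: algebra_simps)
    then show ?thesis by (rule bexI[OF _ add_mem[OF g g']])
  qed
  with square_integrable_add(1)[OF sq] show ?thesis by (simp add: L2_closure_def)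
qed

lemma closure_cmult:
  assumes f: "f \<in> L2_closure"
  shows "(\<lambda>x. c * f x) \<in> L2_closure"
proof -
  have "\<exists>g\<in>S. (LINT x|M. (cmod (c * f x - g x))\<^sup>2) < \<epsilon>" if e: "\<epsilon> > 0" for \<epsilon>
  proof -
    \<comment> \<open>The added 1 keeps the divisor positive when \<open>c\<close> is 0.\<close>
    have p: "(cmod c)\<^sup>2 + 1 > 0" by (simp add: add_nonneg_pos)
    obtain g where g: "g \<in> S" and fg: "(LINT x|M. (cmod (f x - g x))\<^sup>2) < \<epsilon> / ((cmod c)\<^sup>2 + 1)"
      using f e p unfolding L2_closure_def by (auto dest!: spec[of _ "\<epsilon> / ((cmod c)\<^sup>2 + 1)"])
    have "(LINT x|M. (cmod (c * f x - c * g x))\<^sup>2) = (cmod c)\<^sup>2 * (LINT x|M. (cmod (f x - g x))\<^sup>2)"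
      by (simp add: right_diff_distrib[symmetric] norm_mult power_mult_distrib)
    also have "\<dots> \<le> ((cmod c)\<^sup>2 + 1) * (LINT x|M. (cmod (f x - g x))\<^sup>2)"
      by (intro mult_right_mono) auto
    also have "\<dots> < \<epsilon>" using fg p by (simp add: field_simps)
    finally show ?thesis by (rule bexI[OF _ cmult_mem[OF g]])
  qed
  with square_integrable_cmult[OF closure_square_integrable[OF f]] show ?thesis
    by (simp add: L2_closure_def)
qed

lemma closure_sum:
  assumes "\<And>i. i \<in> F \<Longrightarrow> f i \<in> L2_closure"
  shows "(\<lambda>x. \<Sum>i\<in>F. f i x) \<in> L2_closure"
  using assms
  by (induction F rule: infinite_finite_induct) (auto intro: closure_add subset_closure[OF zero_mem])

lemma closure_dominated_convergence:
  assumes h: "\<And>n. h n \<in> L2_closure" and f: "f \<in> borel_measurable M"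
    and lim: "\<And>x. x \<in> space M \<Longrightarrow> (\<lambda>n. h n x) \<longlonglongrightarrow> f x"
    and bound: "\<And>n x. x \<in> space M \<Longrightarrow> cmod (h n x) \<le> G x"
    and G: "integrable M (\<lambda>x. (G x)\<^sup>2)"
  shows "f \<in> L2_closure"
proof (rule closure_approx)
  note D = square_integrable_dominated_convergence[OF square_integrable_measurable[OF closure_square_integrable[OF h]] f lim bound G]
  show "square_integrable M f" by (rule D(1))
  fix \<epsilon> :: real assume "\<epsilon> > 0"
  with D(2) have "\<forall>\<^sub>F n in sequentially. (LINT x|M. (cmod (f x - h n x))\<^sup>2) < \<epsilon>"
    by (rule order_tendstoD(2))
  then obtain n where "(LINT x|M. (cmod (f x - h n x))\<^sup>2) < \<epsilon>"
    by (auto simp: eventually_sequentially)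
  with h show "\<exists>h\<in>L2_closure. (LINT x|M. (cmod (f x - h x))\<^sup>2) < \<epsilon>" by blast
qed

section \<open>From continuous to Borel functions of a fixed map\<close>

text \<open>The continuous ramps max 0 (1 - n dist(z, C)) equal 1 on \<open>C\<close> and are
  eventually 0 at each point off \<open>C\<close>, because a closed set has positive distance from
  every point outside it. They converge pointwise to the indicator and are bounded by 1.\<close>

lemma closure_indicator_closed:
  fixes \<phi> :: "'a \<Rightarrow> 'b::metric_space"
  assumes \<phi>[measurable]: "\<phi> \<in> borel_measurable M"
    and cont: "\<And>g::'b \<Rightarrow> real. continuous_on UNIV g \<Longrightarrow> range g \<subseteq> {0..1} \<Longrightarrow> (\<lambda>x. complex_of_real (g (\<phi> x))) \<in> L2_closure"
    and C: "closed C"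
  shows "(\<lambda>x. indicator C (\<phi> x)) \<in> L2_closure"
proof (cases "C = {}")
  \<comment> \<open>By convention \<open>infdist\<close> to the empty set is 0, so the ramps would
    be constantly 1 here; this case is separate.\<close>
  case True
  then show ?thesis by (simp add: subset_closure zero_mem)
next
  case False
  let ?g = "\<lambda>n z. max 0 (1 - real n * infdist z C)"
  have [measurable]: "C \<in> sets borel" using C by simp
  show ?thesis
  proof (rule closure_dominated_convergence[where h = "\<lambda>n x. complex_of_real (?g n (\<phi> x))" and G = "\<lambda>_. 1"])
    show "(\<lambda>x. complex_of_real (?g n (\<phi> x))) \<in> L2_closure" for n
      by (rule cont) (auto intro!: continuous_intros simp: infdist_nonneg)
    show "(\<lambda>x. indicator C (\<phi> x) :: complex) \<in> borel_measurable M" by measurable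
    show "cmod (complex_of_real (?g n (\<phi> x))) \<le> 1" for n x
      by (auto simp: infdist_nonneg)
    show "(\<lambda>n. complex_of_real (?g n (\<phi> x))) \<longlonglongrightarrow> indicator C (\<phi> x)" for x
    proof (cases "\<phi> x \<in> C")
      case True
      then show ?thesis by simp
    next
      case notin: False
      then have d: "infdist (\<phi> x) C > 0"
        using C False by (simp add: infdist_pos_not_in_closed)
      obtain N where N: "1 < real N * infdist (\<phi> x) C"
        using reals_Archimedean3[OF d] by blast
      have "\<forall>\<^sub>F n in sequentially. complex_of_real (?g n (\<phi> x)) = 0"
        unfolding eventually_sequentially
      proof (intro exI allI impI)
        fix n assume "N \<le> n"
        then have "real N * infdist (\<phi> x) C \<le> real n * infdist (\<phi> x) C"
          using d by (intro mult_right_mono) auto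
        with N show "complex_of_real (?g n (\<phi> x)) = 0" by simp
      qed
      with notin show ?thesis by (simp add: tendsto_eventually)
    qed
  qed auto
qed

text \<open>Dynkin's argument: closed sets are stable under intersection and generate the Borel
  sets, and the sets whose indicator lies in the closure are stable under complements (by linearity)
  and countable disjoint unions (by dominated convergence).\<close>

lemma closure_indicator_borel:
  fixes \<phi> :: "'a \<Rightarrow> 'b::metric_space"
  assumes \<phi>[measurable]: "\<phi> \<in> borel_measurable M"
    and cont: "\<And>g::'b \<Rightarrow> real. continuous_on UNIV g \<Longrightarrow> range g \<subseteq> {0..1} \<Longrightarrow> (\<lambda>x. complex_of_real (g (\<phi> x))) \<in> L2_closure"
    and B: "B \<in> sets borel"
  shows "(\<lambda>x. indicator B (\<phi> x)) \<in> L2_closure"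
proof -
  note cl = closure_indicator_closed[OF \<phi> cont]
  have "Int_stable (Collect closed :: 'b set set)"
    by (auto simp: Int_stable_def)
  moreover have "(Collect closed :: 'b set set) \<subseteq> Pow UNIV" by simp
  moreover have "B \<in> sigma_sets UNIV (Collect closed)"
    using B by (simp add: borel_eq_closed)
  ultimately show ?thesis
  proof (induction rule: sigma_sets_induct_disjoint)
    case (basic A)
    then show ?case using cl by simp
  next
    case empty
    show ?case using cl[of "{}"] by simp
  next
    case (compl A)
    have "(\<lambda>x. indicator UNIV (\<phi> x) + (-1) * indicator A (\<phi> x)) \<in> L2_closure"
      by (intro closure_add closure_cmult compl.IH cl) auto
    then show ?case by (simp add: indicator_diff)
  next
    case (union A)
    have A[measurable]: "A n \<in> sets borel" for n
      using union.hyps(2) by (auto simp: borel_eq_closed)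
    have [measurable]: "(\<Union> (range A)) \<in> sets borel" by auto
    have disj: "disjoint_family A" by (rule union.hyps)
    \<comment> \<open>By disjointness the partial sums are themselves indicators, hence bounded by 1
      uniformly in \<open>n\<close>.\<close>
    have eq: "(\<Sum>i<n. indicator (A i) z) = (indicator (\<Union>i<n. A i) z :: complex)" for n z
      by (rule indicator_UN_disjoint[symmetric]) (auto intro: disjoint_family_on_mono[OF _ disj])
    show ?case
    proof (rule closure_dominated_convergence[where h = "\<lambda>n x. indicator (\<Union>i<n. A i) (\<phi> x)" and G = "\<lambda>_. 1"])
      show "(\<lambda>x. indicator (\<Union>i<n. A i) (\<phi> x)) \<in> L2_closure" for n
        unfolding eq[symmetric] by (intro closure_sum union.IH)
      show "(\<lambda>x. indicator (\<Union> (range A)) (\<phi> x) :: complex) \<in> borel_measurable M" by measurable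
      show "(\<lambda>n. indicator (\<Union>i<n. A i) (\<phi> x) :: complex) \<longlonglongrightarrow> indicator (\<Union> (range A)) (\<phi> x)" for x
        by (rule LIMSEQ_indicator_UN)
    qed (auto simp: indicator_def)
  qed
qed

text \<open>Simple functions converging to \<open>F\<close> with modulus at most 2 |F| pull back
  along \<phi> to finite combinations of indicators, and 2 |F| composed with \<phi> is a
  square-integrable dominating function.\<close>

lemma closure_borel_composition:
  fixes \<phi> :: "'a \<Rightarrow> 'b::metric_space"
  assumes \<phi>[measurable]: "\<phi> \<in> borel_measurable M"
    and cont: "\<And>g::'b \<Rightarrow> real. continuous_on UNIV g \<Longrightarrow> range g \<subseteq> {0..1} \<Longrightarrow> (\<lambda>x. complex_of_real (g (\<phi> x))) \<in> L2_closure"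
    and F[measurable]: "F \<in> borel_measurable borel"
    and sq: "square_integrable M (\<lambda>x. F (\<phi> x))"
  shows "(\<lambda>x. F (\<phi> x)) \<in> L2_closure"
proof -
  obtain s where s: "\<And>i. simple_function borel (s i)" "\<And>z. (\<lambda>i. s i z) \<longlonglongrightarrow> F z"
    "\<And>i z. cmod (s i z) \<le> 2 * cmod (F z)"
    using borel_measurable_implies_sequence_metric[OF F, of 0] by (auto simp: dist_norm)
  show ?thesis
  proof (rule closure_dominated_convergence[where h = "\<lambda>n x. s n (\<phi> x)" and G = "\<lambda>x. 2 * cmod (F (\<phi> x))"])
    fix n
    have "(\<lambda>x. \<Sum>y\<in>range (s n). y * indicator (s n -` {y}) (\<phi> x)) \<in> L2_closure"
      using simple_functionD(2)[OF s(1)[of n]]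
      by (intro closure_sum closure_cmult closure_indicator_borel[OF \<phi> cont]) auto
    also have "(\<lambda>x. \<Sum>y\<in>range (s n). y * indicator (s n -` {y}) (\<phi> x)) = (\<lambda>x. s n (\<phi> x))"
      by (subst simple_function_indicator_representation_banach[OF s(1)])
         (auto intro!: sum.cong simp: indicator_def)
    finally show "(\<lambda>x. s n (\<phi> x)) \<in> L2_closure" .
  next
    show "integrable M (\<lambda>x. (2 * cmod (F (\<phi> x)))\<^sup>2)"
      using sq by (simp add: square_integrable_def power_mult_distrib)
  qed (auto intro: s)
qed

end

section \<open>Parseval comparison\<close>

lemma cnj_measurable [measurable]: "cnj \<in> borel_measurable borel"
  by (intro borel_measurable_continuous_onI continuous_intros)

lemma square_integrable_mult_cnj:
  assumes f: "square_integrable M f" and g: "square_integrable M g"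
  shows "integrable M (\<lambda>x. f x * cnj (g x))"
proof (rule Bochner_Integration.integrable_bound)
  show "integrable M (\<lambda>x. (cmod (f x))\<^sup>2 + (cmod (g x))\<^sup>2)"
    using assms by (simp add: square_integrable_def)
  show "(\<lambda>x. f x * cnj (g x)) \<in> borel_measurable M"
    using assms by measurable
  have "cmod (f x) * cmod (g x) \<le> (cmod (f x))\<^sup>2 + (cmod (g x))\<^sup>2" for x
    using sum_squares_bound[of "cmod (f x)" "cmod (g x)"]
      mult_nonneg_nonneg[OF norm_ge_zero norm_ge_zero, of "f x" "g x"] by linarith
  then show "AE x in M. norm (f x * cnj (g x)) \<le> norm ((cmod (f x))\<^sup>2 + (cmod (g x))\<^sup>2)"
    by (simp add: norm_mult)
qed

lemma L2_inner_self: "L2_inner M f f = complex_of_real (LINT x|M. (cmod (f x))\<^sup>2)"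
  unfolding L2_inner_def by (simp only: complex_norm_square[symmetric] integral_complex_of_real)

lemma L2_inner_diff_sum_left:
  assumes "square_integrable M f" "square_integrable M g" "\<And>i. i \<in> F \<Longrightarrow> square_integrable M (e i)"
  shows "L2_inner M (\<lambda>x. f x - (\<Sum>i\<in>F. c i * e i x)) g = L2_inner M f g - (\<Sum>i\<in>F. c i * L2_inner M (e i) g)"
proof -
  have "L2_inner M (\<lambda>x. f x - (\<Sum>i\<in>F. c i * e i x)) g
      = (LINT x|M. f x * cnj (g x) - (\<Sum>i\<in>F. c i * (e i x * cnj (g x))))"
    by (simp add: L2_inner_def left_diff_distrib sum_distrib_right mult.assoc)
  also have "\<dots> = L2_inner M f g - (\<Sum>i\<in>F. c i * L2_inner M (e i) g)"
    using assms by (simp add: L2_inner_def square_integrable_mult_cnj)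
  finally show ?thesis .
qed

text \<open>Completing the square in \<open>c\<close>: the distance from \<open>f\<close> to the
  line spanned by a unit vector is least at the Fourier coefficient.\<close>

lemma L2_norm_diff_unit:
  assumes f: "square_integrable M f" and e: "square_integrable M e" and unit: "L2_inner M e e = 1"
  shows "(LINT x|M. (cmod (f x - c * e x))\<^sup>2) =
    (LINT x|M. (cmod (f x))\<^sup>2) - (cmod (L2_inner M f e))\<^sup>2 + (cmod (c - L2_inner M f e))\<^sup>2"
proof -
  let ?z = "L2_inner M f e"
  have fe: "integrable M (\<lambda>x. f x * cnj (e x))"
    by (rule square_integrable_mult_cnj[OF f e])
  have sq: "integrable M (\<lambda>x. (cmod (f x))\<^sup>2)" "integrable M (\<lambda>x. (cmod (e x))\<^sup>2)"
    using f e by (auto simp: square_integrable_def)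
  have e1: "(LINT x|M. (cmod (e x))\<^sup>2) = 1"
    using unit by (simp add: L2_inner_self)
  have pt: "(cmod (u - c * v))\<^sup>2 = (cmod u)\<^sup>2 - 2 * Re (cnj c * (u * cnj v)) + (cmod c)\<^sup>2 * (cmod v)\<^sup>2" for u v
    unfolding cmod_power2 by (simp add: power2_eq_square algebra_simps)
  define r where "r x = Re (cnj c * (f x * cnj (e x)))" for x
  have r: "integrable M r"
    unfolding r_def by (intro integrable_Re integrable_mult_right fe)
  have "(LINT x|M. (cmod (f x - c * e x))\<^sup>2)
      = (LINT x|M. (cmod (f x))\<^sup>2) - 2 * (LINT x|M. Re (cnj c * (f x * cnj (e x)))) + (cmod c)\<^sup>2"
    unfolding pt r_def[symmetric] using r sq e1 by simp
  also have "(LINT x|M. Re (cnj c * (f x * cnj (e x)))) = Re (cnj c * ?z)"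
    unfolding L2_inner_def using fe by (subst integral_Re) simp_all
  also have "(LINT x|M. (cmod (f x))\<^sup>2) - 2 * Re (cnj c * ?z) + (cmod c)\<^sup>2
      = (LINT x|M. (cmod (f x))\<^sup>2) - (cmod ?z)\<^sup>2 + (cmod (c - ?z))\<^sup>2"
    unfolding cmod_power2 by (simp add: power2_eq_square algebra_simps)
  finally show ?thesis .
qed

text \<open>The members are subtracted one at a time; by orthogonality, subtracting the others
  leaves the coefficient at \<open>e j\<close> unchanged. Allowing arbitrary \<open>c\<close> lets
  the identity serve both for Bessel's inequality and for estimating a given approximation.\<close>

lemma L2_norm_diff_orthonormal_sum:
  assumes f: "square_integrable M f"
    and e: "\<And>i. i \<in> F \<Longrightarrow> square_integrable M (e i)"
    and on: "\<And>i j. i \<in> F \<Longrightarrow> j \<in> F \<Longrightarrow> L2_inner M (e i) (e j) = (if i = j then 1 else 0)"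
    and fin: "finite F"
  shows "(LINT x|M. (cmod (f x - (\<Sum>i\<in>F. c i * e i x)))\<^sup>2) =
    (LINT x|M. (cmod (f x))\<^sup>2) - (\<Sum>i\<in>F. (cmod (L2_inner M f (e i)))\<^sup>2)
      + (\<Sum>i\<in>F. (cmod (c i - L2_inner M f (e i)))\<^sup>2)"
  using fin e on
proof (induction F)
  case empty
  show ?case by simp
next
  case (insert j F)
  let ?g = "\<lambda>x. f x - (\<Sum>i\<in>F. c i * e i x)"
  have g: "square_integrable M ?g"
    using insert.prems(1) by (intro square_integrable_diff[OF f] square_integrable_sum) auto
  have "L2_inner M (e i) (e j) = 0" if "i \<in> F" for i
    using insert.prems(2)[of i j] insert.hyps(2) that by auto
  then have gj: "L2_inner M ?g (e j) = L2_inner M f (e j)"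
    using insert.prems(1) by (subst L2_inner_diff_sum_left) (auto intro: f)
  have "(LINT x|M. (cmod (f x - (\<Sum>i\<in>insert j F. c i * e i x)))\<^sup>2) = (LINT x|M. (cmod (?g x - c j * e j x))\<^sup>2)"
    using insert.hyps by (simp add: algebra_simps)
  also have "\<dots> = (LINT x|M. (cmod (?g x))\<^sup>2) - (cmod (L2_inner M f (e j)))\<^sup>2 + (cmod (c j - L2_inner M f (e j)))\<^sup>2"
    using L2_norm_diff_unit[OF g, of "e j" "c j"] insert.prems unfolding gj by auto
  also have "(LINT x|M. (cmod (?g x))\<^sup>2) = (LINT x|M. (cmod (f x))\<^sup>2) - (\<Sum>i\<in>F. (cmod (L2_inner M f (e i)))\<^sup>2)
      + (\<Sum>i\<in>F. (cmod (c i - L2_inner M f (e i)))\<^sup>2)"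
    using insert.prems by (intro insert.IH) auto
  finally show ?case using insert.hyps by simp
qed

text \<open>Half of Parseval for each function: density bounds the norm of \<open>f\<close> by
  finitely many of its coefficients up to \<epsilon>, and Bessel's inequality bounds the same sum
  for \<open>g\<close> by the norm of \<open>g\<close>. Exchanging \<open>f\<close> and
  \<open>g\<close> gives equality of norms.\<close>

lemma L2_norm_le_of_coefficients_eq:
  assumes B: "L2_orthonormal_basis M I e"
    and f: "square_integrable M f" and g: "square_integrable M g"
    and eq: "\<And>i. i \<in> I \<Longrightarrow> cmod (L2_inner M f (e i)) = cmod (L2_inner M g (e i))"
  shows "(LINT x|M. (cmod (f x))\<^sup>2) \<le> (LINT x|M. (cmod (g x))\<^sup>2)"
proof (rule field_le_epsilon)
  fix \<epsilon> :: real assume "\<epsilon> > 0"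
  then have "sqrt \<epsilon> > 0" by simp
  with B f obtain F c where F: "finite F" "F \<subseteq> I"
    and "L2_norm M (\<lambda>x. f x - (\<Sum>i\<in>F. c i * e i x)) < sqrt \<epsilon>"
    unfolding L2_orthonormal_basis_def by blast
  then have small: "(LINT x|M. (cmod (f x - (\<Sum>i\<in>F. c i * e i x)))\<^sup>2) < \<epsilon>"
    by (simp add: L2_norm_def)
  have e: "square_integrable M (e i)" if "i \<in> F" for i
    using B F(2) that unfolding L2_orthonormal_basis_def by blast
  have on: "L2_inner M (e i) (e j) = (if i = j then 1 else 0)" if "i \<in> F" "j \<in> F" for i j
    using B F(2) that unfolding L2_orthonormal_basis_def by blast
  \<comment> \<open>Whatever the coefficients \<open>c\<close> of the approximation are, the Fourier
    coefficients do at least as well.\<close>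
  have "(LINT x|M. (cmod (f x))\<^sup>2) - (\<Sum>i\<in>F. (cmod (L2_inner M f (e i)))\<^sup>2) < \<epsilon>"
    using small sum_nonneg[of F "\<lambda>i. (cmod (c i - L2_inner M f (e i)))\<^sup>2"]
      L2_norm_diff_orthonormal_sum[OF f e on F(1), of c] by simp
  \<comment> \<open>With the Fourier coefficients themselves the last sum of the identity vanishes,
    which leaves Bessel's inequality.\<close>
  moreover have "0 \<le> (LINT x|M. (cmod (g x - (\<Sum>i\<in>F. L2_inner M g (e i) * e i x)))\<^sup>2)"
    by simp
  then have "0 \<le> (LINT x|M. (cmod (g x))\<^sup>2) - (\<Sum>i\<in>F. (cmod (L2_inner M g (e i)))\<^sup>2)"
    using L2_norm_diff_orthonormal_sum[OF g e on F(1), of "\<lambda>i. L2_inner M g (e i)"] by simp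
  moreover have "(\<Sum>i\<in>F. (cmod (L2_inner M f (e i)))\<^sup>2) = (\<Sum>i\<in>F. (cmod (L2_inner M g (e i)))\<^sup>2)"
    using F eq by (intro sum.cong) auto
  ultimately show "(LINT x|M. (cmod (f x))\<^sup>2) \<le> (LINT x|M. (cmod (g x))\<^sup>2) + \<epsilon>" by linarith
qed

section \<open>Measures on two parallel segments\<close>

definition two_segments :: "real \<Rightarrow> real \<Rightarrow> real \<Rightarrow> real \<Rightarrow> real \<Rightarrow> real \<Rightarrow> real \<Rightarrow> real \<Rightarrow> (real \<times> real) measure" where
  "two_segments a1 T1 c1 h1 a2 T2 c2 h2 = add_measure
      (scale_measure (ennreal c1) (lebesgue_restr {a1..a1 + T1} \<Otimes>\<^sub>M return borel h1))
      (scale_measure (ennreal c2) (lebesgue_restr {a2..a2 + T2} \<Otimes>\<^sub>M return borel h2))"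

lemma sets_two_segments: "sets (two_segments a1 T1 c1 h1 a2 T2 c2 h2) = sets borel"
  unfolding two_segments_def sets_add_measure sets_scale_measure sets_lebesgue_restr_pair_return ..

text \<open>
  With the segments laid end to end on \<open>{a..b}\<close> and \<open>{b<..d}\<close>, \<open>unfold_density\<close> is the density of
  the resulting measure on the line, and \<open>fold_line\<close> maps the line back to the two segments.
\<close>

definition unfold_density :: "real \<Rightarrow> real \<Rightarrow> real \<Rightarrow> real \<Rightarrow> real \<Rightarrow> real \<Rightarrow> real" where
  "unfold_density a b d c1 c2 t = c1 * indicator {a..b} t + c2 * indicator {b<..d} t"

definition fold_line :: "real \<Rightarrow> real \<Rightarrow> real \<Rightarrow> real \<Rightarrow> real \<Rightarrow> real \<times> real" where
  "fold_line b s h1 h2 t = (if t \<le> b then (t, h1) else (t - s, h2))"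

lemma fold_line_measurable [measurable]: "fold_line b s h1 h2 \<in> borel_measurable borel"
  unfolding fold_line_def by measurable

lemma unfold_density_measurable [measurable]: "unfold_density a b d c1 c2 \<in> borel_measurable borel"
  unfolding unfold_density_def by measurable

lemma emeasure_lebesgue_restr_pair_return:
  assumes [measurable]: "E \<in> sets borel" "A \<in> sets (borel :: (real \<times> real) measure)"
  shows "emeasure (lebesgue_restr E \<Otimes>\<^sub>M return borel h) A = (\<integral>\<^sup>+t. indicator E t * indicator A (t, h) \<partial>lborel)"
proof -
  interpret prob_space "return borel h" by (simp add: prob_space_return)
  have "emeasure (lebesgue_restr E \<Otimes>\<^sub>M return borel h) A
      = (\<integral>\<^sup>+t. emeasure (return borel h) (Pair t -` A) \<partial>lebesgue_restr E)"
    by (rule emeasure_pair_measure_alt) (unfold sets_lebesgue_restr_pair_return, fact)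
  also have "\<dots> = (\<integral>\<^sup>+t. indicator A (t, h) \<partial>lebesgue_restr E)"
  proof (intro nn_integral_cong)
    fix t :: real
    have "Pair t -` A \<in> sets borel"
      by (rule measurable_sets_borel[OF _ assms(2)]) measurable
    then show "emeasure (return borel h) (Pair t -` A) = indicator A (t, h)"
      by (simp add: indicator_def)
  qed
  also have "\<dots> = (\<integral>\<^sup>+t. indicator E t * indicator A (t, h) \<partial>lborel)"
    unfolding lebesgue_restr_def by (subst nn_integral_density) auto
  finally show ?thesis .
qed

text \<open>Every integral against the planar measure becomes an integral on the line. The point
  \<open>a1 + T1\<close> can belong to one piece only, and \<open>fold_line\<close> gives it to the
  first segment.\<close>

lemma two_segments_eq_distr:
  assumes c: "c1 \<ge> 0" "c2 \<ge> 0"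
  shows "two_segments a1 T1 c1 h1 a2 T2 c2 h2 =
    distr (density lborel (\<lambda>t. ennreal (unfold_density a1 (a1 + T1) (a1 + T1 + T2) c1 c2 t))) borel
      (fold_line (a1 + T1) (a1 + T1 - a2) h1 h2)"
    (is "?L = distr ?M borel ?p")
proof (rule measure_eqI)
  show "sets ?L = sets (distr ?M borel ?p)"
    by (simp add: sets_two_segments)
  fix A assume "A \<in> sets ?L"
  then have A[measurable]: "A \<in> sets borel"
    by (simp add: sets_two_segments)
  let ?b = "a1 + T1"
  have L: "emeasure ?L A = ennreal c1 * (\<integral>\<^sup>+t. indicator {a1..?b} t * indicator A (t, h1) \<partial>lborel)
     + ennreal c2 * (\<integral>\<^sup>+t. indicator {a2..a2 + T2} t * indicator A (t, h2) \<partial>lborel)"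
    unfolding two_segments_def
    using A
    by (subst emeasure_add_measure)
       (unfold sets_scale_measure sets_lebesgue_restr_pair_return emeasure_scale_measure,
        simp_all add: emeasure_lebesgue_restr_pair_return)
  \<comment> \<open>The left endpoint of the second segment is a null set; dropping it matches the
    half-open second piece. The translation then places that piece after the first.\<close>
  have "(\<integral>\<^sup>+t. indicator {a2..a2 + T2} t * indicator A (t, h2) \<partial>lborel)
      = (\<integral>\<^sup>+t. indicator {a2<..a2 + T2} t * indicator A (t, h2) \<partial>lborel)"
    by (intro nn_integral_cong_AE eventually_mono[OF AE_lborel_singleton[of a2]]) (auto simp: indicator_def)
  also have "\<dots> = (\<integral>\<^sup>+t. indicator {?b<..?b + T2} t * indicator A (t - (?b - a2), h2) \<partial>lborel)"
    by (subst nn_integral_real_affine[where c = 1 and t = "a2 - ?b"])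
       (auto intro!: nn_integral_cong simp: indicator_def algebra_simps)
  finally have shift: "(\<integral>\<^sup>+t. indicator {a2..a2 + T2} t * indicator A (t, h2) \<partial>lborel)
      = (\<integral>\<^sup>+t. indicator {?b<..?b + T2} t * indicator A (t - (?b - a2), h2) \<partial>lborel)" .
  have "emeasure (distr ?M borel ?p) A = (\<integral>\<^sup>+t. indicator A t \<partial>distr ?M borel ?p)"
    by simp
  also have "\<dots> = (\<integral>\<^sup>+t. ennreal (unfold_density a1 ?b (?b + T2) c1 c2 t) * indicator A (?p t) \<partial>lborel)"
    by (subst nn_integral_distr, simp, simp, subst nn_integral_density, auto)
  also have "\<dots> = (\<integral>\<^sup>+t. ennreal c1 * (indicator {a1..?b} t * indicator A (t, h1))
      + ennreal c2 * (indicator {?b<..?b + T2} t * indicator A (t - (?b - a2), h2)) \<partial>lborel)"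
    by (intro nn_integral_cong) (auto simp: indicator_def unfold_density_def fold_line_def)
  also have "\<dots> = emeasure ?L A"
    unfolding L shift by (subst nn_integral_add) (auto simp: nn_integral_cmult)
  finally show "emeasure ?L A = emeasure (distr ?M borel ?p) A" ..
qed

lemma integral_two_segments:
  fixes G :: "real \<times> real \<Rightarrow> 'b::{banach, second_countable_topology}"
  assumes c: "c1 \<ge> 0" "c2 \<ge> 0" and [measurable]: "G \<in> borel_measurable borel"
  shows "integral\<^sup>L (two_segments a1 T1 c1 h1 a2 T2 c2 h2) G =
    (LINT t|lborel. unfold_density a1 (a1 + T1) (a1 + T1 + T2) c1 c2 t *\<^sub>R
       G (fold_line (a1 + T1) (a1 + T1 - a2) h1 h2 t))"
proof -
  have nn: "unfold_density a b d c1 c2 t \<ge> 0" for a b d t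
    using c by (simp add: unfold_density_def)
  show ?thesis
    unfolding two_segments_eq_distr[OF c]
    by (subst integral_distr) (auto simp: integral_density nn)
qed

lemma two_segments_total_mass:
  assumes "c1 \<ge> 0" "c2 \<ge> 0" "T1 \<ge> 0" "T2 \<ge> 0" and "prob_space (two_segments a1 T1 c1 h1 a2 T2 c2 h2)"
  shows "c1 * T1 + c2 * T2 = 1"
proof -
  interpret prob_space "two_segments a1 T1 c1 h1 a2 T2 c2 h2" by fact
  have "1 = (LINT x|two_segments a1 T1 c1 h1 a2 T2 c2 h2. 1::real)"
    using prob_space by simp
  also have "\<dots> = c1 * T1 + c2 * T2"
    using assms by (subst integral_two_segments) (auto simp: unfold_density_def)
  finally show ?thesis by simp
qed

text \<open>As \<open>h1\<close> and \<open>h2\<close> differ, the indicator vanishes on the other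
  segment, and \<open>T \<le> T1\<close> keeps the piece inside its own, where the density is
  \<open>c1\<close>.\<close>

lemma integral_left_segment:
  fixes G :: "real \<times> real \<Rightarrow> 'b::{banach, second_countable_topology}"
  assumes c: "c1 \<ge> 0" "c2 \<ge> 0" and "h1 \<noteq> h2" and "T \<le> T1"
    and [measurable]: "G \<in> borel_measurable borel"
  shows "(LINT x|two_segments a1 T1 c1 h1 a2 T2 c2 h2. indicator ({a1<..a1 + T} \<times> {h1}) x *\<^sub>R G x)
    = c1 *\<^sub>R (LINT t|lborel. indicator {a1<..a1 + T} t *\<^sub>R G (t, h1))"
proof -
  have [measurable]: "{a1<..a1 + T} \<times> {h1} \<in> sets borel" by (intro borel_Times) auto
  have "(LINT x|two_segments a1 T1 c1 h1 a2 T2 c2 h2. indicator ({a1<..a1 + T} \<times> {h1}) x *\<^sub>R G x)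
      = (LINT t|lborel. c1 *\<^sub>R (indicator {a1<..a1 + T} t *\<^sub>R G (t, h1)))"
    using assms(3,4)
    by (subst integral_two_segments[OF c])
       (auto intro!: Bochner_Integration.integral_cong simp: indicator_def unfold_density_def fold_line_def)
  then show ?thesis by (simp only: integral_scaleR_right)
qed

text \<open>The integration variable is shifted so that it runs over the same interval as for the
  left segment; the integrand is then evaluated at translated points, which makes the two formulas
  directly comparable.\<close>

lemma integral_right_segment:
  fixes G :: "real \<times> real \<Rightarrow> 'b::{banach, second_countable_topology}"
  assumes c: "c1 \<ge> 0" "c2 \<ge> 0" and "h1 \<noteq> h2" and "T \<le> T2"
    and [measurable]: "G \<in> borel_measurable borel"
  shows "(LINT x|two_segments a1 T1 c1 h1 a2 T2 c2 h2. indicator ({a2<..a2 + T} \<times> {h2}) x *\<^sub>R G x)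
    = c2 *\<^sub>R (LINT t|lborel. indicator {a1<..a1 + T} t *\<^sub>R G (t + (a2 - a1), h2))"
proof -
  let ?b = "a1 + T1"
  have [measurable]: "{a2<..a2 + T} \<times> {h2} \<in> sets borel" by (intro borel_Times) auto
  have "(LINT x|two_segments a1 T1 c1 h1 a2 T2 c2 h2. indicator ({a2<..a2 + T} \<times> {h2}) x *\<^sub>R G x)
      = (LINT t|lborel. c2 *\<^sub>R (indicator {?b<..?b + T} t *\<^sub>R G (t - (?b - a2), h2)))"
    using assms(3,4)
    by (subst integral_two_segments[OF c])
       (auto intro!: Bochner_Integration.integral_cong simp: indicator_def unfold_density_def fold_line_def)
  also have "\<dots> = c2 *\<^sub>R (LINT t|lborel. indicator {?b<..?b + T} t *\<^sub>R G (t - (?b - a2), h2))"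
    by (simp only: integral_scaleR_right)
  also have "(LINT t|lborel. indicator {?b<..?b + T} t *\<^sub>R G (t - (?b - a2), h2))
      = (LINT t|lborel. indicator {a1<..a1 + T} t *\<^sub>R G (t + (a2 - a1), h2))"
    by (subst lborel_integral_real_affine[where c = 1 and t = T1])
       (auto intro!: Bochner_Integration.integral_cong simp: indicator_def algebra_simps)
  finally show ?thesis .
qed

section \<open>Plane waves and the necessity of equal weights\<close>

lemma exponential_add_right: "exponential \<xi> (x + y) = exponential \<xi> x * exponential \<xi> y"
  by (simp add: exponential_def inner_add_right exp_add ring_distribs)

lemma cmod_exponential [simp]: "cmod (exponential \<xi> x) = 1"
  by (simp add: exponential_def norm_exp_eq_Re)

lemma exponential_measurable [measurable]: "exponential \<xi> \<in> borel_measurable borel"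
  unfolding exponential_def by measurable

text \<open>Translating a piece multiplies its Fourier coefficients by unimodular numbers, whatever
  the frequency. Coefficient moduli thus cannot tell the two normalised pieces apart, so their norms
  must agree, and these depend on the weights.\<close>

lemma spectral_imp_equal_weights:
  assumes h: "h1 \<noteq> h2" and T: "T1 > 0" "T2 > 0" and c: "c1 > 0" "c2 > 0"
    and S: "spectral_measure (two_segments a1 T1 c1 h1 a2 T2 c2 h2)" (is "spectral_measure ?\<mu>")
  shows "c1 = c2"
proof -
  from S obtain \<Lambda> where sets: "sets ?\<mu> = sets borel" and "prob_space ?\<mu>"
    and B: "L2_orthonormal_basis ?\<mu> \<Lambda> exponential"
    by (auto simp: spectral_measure_def is_spectrum_def)
  interpret prob_space ?\<mu> by fact
  note [measurable_cong] = sets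
  \<comment> \<open>The largest length for which a piece fits into both segments.\<close>
  define T where "T = min T1 T2"
  have T0: "T > 0" "T \<le> T1" "T \<le> T2" using T by (auto simp: T_def)
  \<comment> \<open>The factor 1 / \<open>c1\<close> cancels the weight in inner products with
    exponentials, but the squared norm, being quadratic in it, keeps one such factor. The same holds
    for \<open>g\<close> and \<open>c2\<close>.\<close>
  define f where "f x = indicator ({a1<..a1 + T} \<times> {h1}) x *\<^sub>R complex_of_real (1 / c1)" for x
  define g where "g x = indicator ({a2<..a2 + T} \<times> {h2}) x *\<^sub>R complex_of_real (1 / c2)" for x
  note c' = less_imp_le[OF c(1)] less_imp_le[OF c(2)]
  have [measurable]: "{a1<..a1 + T} \<times> {h1} \<in> sets borel" "{a2<..a2 + T} \<times> {h2} \<in> sets borel"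
    by (intro borel_Times; simp)+
  have fg[measurable]: "f \<in> borel_measurable borel" "g \<in> borel_measurable borel"
    unfolding f_def g_def by measurable
  have f: "square_integrable ?\<mu> f"
    using fg(1)
    by (intro square_integrable_bounded[where B = "1 / c1"], unfold measurable_cong_sets[OF sets refl])
       (use c in \<open>auto simp: f_def indicator_def norm_divide\<close>)
  have g: "square_integrable ?\<mu> g"
    using fg(2)
    by (intro square_integrable_bounded[where B = "1 / c2"], unfold measurable_cong_sets[OF sets refl])
       (use c in \<open>auto simp: g_def indicator_def norm_divide\<close>)
  have len: "measure lborel {a1<..a1 + T} = T" using T0 by simp
  have "(LINT x|?\<mu>. (cmod (f x))\<^sup>2) = (LINT x|?\<mu>. indicator ({a1<..a1 + T} \<times> {h1}) x *\<^sub>R (1 / c1)\<^sup>2)"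
    by (intro Bochner_Integration.integral_cong) (auto simp: f_def indicator_def norm_divide power_divide)
  also have "\<dots> = T / c1"
    by (subst integral_left_segment[OF c' h T0(2)]) (use c T0 in \<open>simp_all add: power2_eq_square\<close>)
  finally have normf: "(LINT x|?\<mu>. (cmod (f x))\<^sup>2) = T / c1" .
  have "(LINT x|?\<mu>. (cmod (g x))\<^sup>2) = (LINT x|?\<mu>. indicator ({a2<..a2 + T} \<times> {h2}) x *\<^sub>R (1 / c2)\<^sup>2)"
    by (intro Bochner_Integration.integral_cong) (auto simp: g_def indicator_def norm_divide power_divide)
  also have "\<dots> = T / c2"
    by (subst integral_right_segment[OF c' h T0(3)]) (use c T0 in \<open>simp_all add: power2_eq_square\<close>)
  finally have normg: "(LINT x|?\<mu>. (cmod (g x))\<^sup>2) = T / c2" .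
  have coeff: "cmod (L2_inner ?\<mu> f (exponential \<xi>)) = cmod (L2_inner ?\<mu> g (exponential \<xi>))" for \<xi>
  proof -
    let ?J = "LINT t|lborel. indicator {a1<..a1 + T} t *\<^sub>R cnj (exponential \<xi> (t, h1))"
    let ?u = "exponential \<xi> (a2 - a1, h2 - h1)"
    have "L2_inner ?\<mu> f (exponential \<xi>)
        = (LINT x|?\<mu>. indicator ({a1<..a1 + T} \<times> {h1}) x *\<^sub>R (complex_of_real (1 / c1) * cnj (exponential \<xi> x)))"
      by (simp add: L2_inner_def f_def)
    also have "\<dots> = c1 *\<^sub>R (LINT t|lborel. complex_of_real (1 / c1) *
        (indicator {a1<..a1 + T} t *\<^sub>R cnj (exponential \<xi> (t, h1))))"
      by (subst integral_left_segment[OF c' h T0(2)]) (auto simp del: of_real_divide)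
    also have "\<dots> = ?J"
      using c by (subst integral_mult_right_zero) (simp add: scaleR_conv_of_real)
    finally have 1: "L2_inner ?\<mu> f (exponential \<xi>) = ?J" .
    \<comment> \<open>Exponentials are characters: the vector from one piece to the other
      contributes a factor independent of \<open>t\<close>.\<close>
    have split: "exponential \<xi> (t + (a2 - a1), h2) = exponential \<xi> (t, h1) * ?u" for t
      unfolding exponential_add_right[symmetric] by simp
    have "L2_inner ?\<mu> g (exponential \<xi>)
        = (LINT x|?\<mu>. indicator ({a2<..a2 + T} \<times> {h2}) x *\<^sub>R (complex_of_real (1 / c2) * cnj (exponential \<xi> x)))"
      by (simp add: L2_inner_def g_def)
    also have "\<dots> = c2 *\<^sub>R (LINT t|lborel. (complex_of_real (1 / c2) * cnj ?u) *
        (indicator {a1<..a1 + T} t *\<^sub>R cnj (exponential \<xi> (t, h1))))"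
      by (subst integral_right_segment[OF c' h T0(3)]) (auto simp del: of_real_divide simp: split mult_ac)
    also have "\<dots> = cnj ?u * ?J"
      using c by (subst integral_mult_right_zero) (simp add: scaleR_conv_of_real)
    finally show ?thesis using 1 by (simp add: norm_mult)
  qed
  have "T / c1 = T / c2"
    using L2_norm_le_of_coefficients_eq[OF B f g coeff] L2_norm_le_of_coefficients_eq[OF B g f coeff[symmetric]]
    unfolding normf normg by (rule antisym)
  then show ?thesis using T0 c by (simp add: field_simps)
qed

section \<open>Completeness of exponentials on an interval\<close>

text \<open>On the unit circle the conjugate of \<open>z\<close> is its inverse, so real and
  imaginary parts are Laurent polynomials in \<open>z\<close>. Multiplying by a power of
  \<open>z\<close> clears the negative exponents, and sums and products stay within this
  form.\<close>

lemma laurent_polynomial_of_real_polynomial_function: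
  assumes "real_polynomial_function p"
  shows "\<exists>N q. \<forall>z. cmod z = 1 \<longrightarrow> z ^ N * complex_of_real (p z) = poly q z"
  using assms
proof induction
  case (linear p)
  interpret bounded_linear p by fact
  let ?a = "complex_of_real (p 1)" and ?b = "complex_of_real (p \<i>)"
  have "z ^ 1 * complex_of_real (p z) = poly [:(?a + \<i> * ?b) / 2, 0, (?a - \<i> * ?b) / 2:] z"
    if "cmod z = 1" for z
  proof -
    \<comment> \<open>A real-linear functional on the complex plane is determined by its values at 1
      and at the imaginary unit.\<close>
    have "p z = p (Re z *\<^sub>R 1 + Im z *\<^sub>R \<i>)"
      by (rule arg_cong[of _ _ p]) (simp add: complex_eq_iff)
    then have pz: "p z = Re z * p 1 + Im z * p \<i>"
      by (simp only: add scaleR) simp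
    have "z * cnj z = 1" using that by (simp add: complex_norm_square[symmetric])
    then have re: "z * Re z = (z\<^sup>2 + 1) / 2" and im: "z * Im z = \<i> * (1 - z\<^sup>2) / 2"
      using complex_add_cnj[of z] complex_diff_cnj[of z]
      by (auto simp: power2_eq_square complex_eq_iff algebra_simps)
    have "z ^ 1 * complex_of_real (p z) = (z * Re z) * ?a + (z * Im z) * ?b"
      by (simp add: pz algebra_simps)
    then show ?thesis
      unfolding re im by (simp add: field_simps power2_eq_square)
  qed
  then show ?case by blast
next
  case (const c)
  have "\<forall>z. cmod z = 1 \<longrightarrow> z ^ 0 * complex_of_real c = poly [:complex_of_real c:] z" by simp
  then show ?case by blast
next
  case (add f g)
  then obtain N q N' q' where
    q: "\<And>z. cmod z = 1 \<Longrightarrow> z ^ N * complex_of_real (f z) = poly q z"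
    and q': "\<And>z. cmod z = 1 \<Longrightarrow> z ^ N' * complex_of_real (g z) = poly q' z" by metis
  have expand: "z ^ (N + N') * complex_of_real (f z + g z)
      = z ^ N' * (z ^ N * complex_of_real (f z)) + z ^ N * (z ^ N' * complex_of_real (g z))" for z
    by (simp add: power_add algebra_simps)
  have "\<forall>z. cmod z = 1 \<longrightarrow> z ^ (N + N') * complex_of_real (f z + g z) = poly (monom 1 N' * q + monom 1 N * q') z"
    by (simp only: expand) (simp add: q q' poly_monom)
  then show ?case by blast
next
  case (mult f g)
  then obtain N q N' q' where
    q: "\<And>z. cmod z = 1 \<Longrightarrow> z ^ N * complex_of_real (f z) = poly q z"
    and q': "\<And>z. cmod z = 1 \<Longrightarrow> z ^ N' * complex_of_real (g z) = poly q' z" by metis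
  have expand: "z ^ (N + N') * complex_of_real (f z * g z)
      = (z ^ N * complex_of_real (f z)) * (z ^ N' * complex_of_real (g z))" for z
    by (simp add: power_add mult_ac)
  have "\<forall>z. cmod z = 1 \<longrightarrow> z ^ (N + N') * complex_of_real (f z * g z) = poly (q * q') z"
    by (simp only: expand) (simp add: q q')
  then show ?case by blast
qed

lemma continuous_circle_approx_powers:
  fixes g :: "complex \<Rightarrow> real"
  assumes "continuous_on (sphere 0 1) g" and "\<epsilon> > 0"
  shows "\<exists>A c. finite A \<and> (\<forall>z. cmod z = 1 \<longrightarrow> cmod (complex_of_real (g z) - (\<Sum>n\<in>A. c n * z powi n)) < \<epsilon>)"
proof -
  obtain p where p: "real_polynomial_function p" and gp: "\<And>z. z \<in> sphere 0 1 \<Longrightarrow> \<bar>g z - p z\<bar> < \<epsilon>"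
    using Stone_Weierstrass_real_polynomial_function[OF compact_sphere assms] by blast
  obtain N q where q: "\<And>z. cmod z = 1 \<Longrightarrow> z ^ N * complex_of_real (p z) = poly q z"
    using laurent_polynomial_of_real_polynomial_function[OF p] by blast
  \<comment> \<open>Dividing \<open>q\<close> by z^N shifts all exponents down by \<open>N\<close>,
    so the coefficient of z^n is the one of \<open>q\<close> at n + N.\<close>
  define A where "A = (\<lambda>i. int i - int N) ` {..degree q}"
  define c where "c n = coeff q (nat (n + int N))" for n
  have "complex_of_real (p z) = (\<Sum>n\<in>A. c n * z powi n)" if z: "cmod z = 1" for z
  proof -
    have z0: "z \<noteq> 0" using z by auto
    have "(\<Sum>n\<in>A. c n * z powi n) = (\<Sum>i\<le>degree q. coeff q i * z powi (int i - int N))"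
      unfolding A_def by (subst sum.reindex) (auto simp: inj_on_def c_def)
    also have "\<dots> = poly q z / z ^ N"
      using z0 by (simp add: poly_altdef sum_divide_distrib power_int_diff)
    also have "\<dots> = complex_of_real (p z)"
      using q[OF z, symmetric] z0 by simp
    finally show ?thesis ..
  qed
  with gp have "\<forall>z. cmod z = 1 \<longrightarrow> cmod (complex_of_real (g z) - (\<Sum>n\<in>A. c n * z powi n)) < \<epsilon>"
    by (metis dist_0_norm mem_sphere norm_of_real of_real_diff)
  moreover have "finite A" by (simp add: A_def)
  ultimately show ?thesis by blast
qed

lemma powi_measurable [measurable]:
  fixes f :: "'a \<Rightarrow> complex"
  shows "f \<in> borel_measurable M \<Longrightarrow> (\<lambda>x. f x powi n) \<in> borel_measurable M"
  by (cases "n \<ge> 0") (simp_all add: power_int_def)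

text \<open>Uniform approximation on the circle by Laurent polynomials is also approximation in mean
  square, since the measure is finite. This puts continuous functions of \<phi> into the closure,
  and Borel functions of \<phi> follow.\<close>

lemma circle_powers_total:
  fixes \<phi> :: "'a \<Rightarrow> complex"
  assumes "finite_measure M" and \<phi>[measurable]: "\<phi> \<in> borel_measurable M"
    and circle: "\<And>x. x \<in> space M \<Longrightarrow> cmod (\<phi> x) = 1"
    and F: "F \<in> borel_measurable borel" and sq: "square_integrable M (\<lambda>x. F (\<phi> x))" and "\<epsilon> > 0"
  shows "\<exists>A c. finite A \<and> (LINT x|M. (cmod (F (\<phi> x) - (\<Sum>n\<in>A. c n * \<phi> x powi n)))\<^sup>2) < \<epsilon>"
proof -
  interpret finite_measure M by fact
  define S where "S = {\<lambda>x. \<Sum>n\<in>A. c n * \<phi> x powi n | A c. finite A}"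
  interpret L2_subspace M S
  proof
    fix g assume "g \<in> S"
    then obtain A c where g: "g = (\<lambda>x. \<Sum>n\<in>A. c n * \<phi> x powi n)" by (auto simp: S_def)
    have "square_integrable M (\<lambda>x. \<phi> x powi n)" for n
      by (rule square_integrable_bounded[where B = 1]) (auto simp: norm_power_int circle)
    then show "square_integrable M g" unfolding g by (rule square_integrable_sum)
  next
    show "(\<lambda>_. 0) \<in> S" by (auto simp: S_def intro!: exI[of _ "{}"])
  next
    fix g h assume "g \<in> S" "h \<in> S"
    then obtain A c B d where fin: "finite A" "finite B"
      and g: "g = (\<lambda>x. \<Sum>n\<in>A. c n * \<phi> x powi n)" and h: "h = (\<lambda>x. \<Sum>n\<in>B. d n * \<phi> x powi n)"
      by (auto simp: S_def)
    have "g x + h x = (\<Sum>n\<in>A\<union>B. ((if n \<in> A then c n else 0) + (if n \<in> B then d n else 0)) * \<phi> x powi n)" for x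
    proof -
      have "g x = (\<Sum>n\<in>A\<union>B. (if n \<in> A then c n else 0) * \<phi> x powi n)"
        unfolding g by (rule sum.mono_neutral_cong_left) (use fin in auto)
      moreover have "h x = (\<Sum>n\<in>A\<union>B. (if n \<in> B then d n else 0) * \<phi> x powi n)"
        unfolding h by (rule sum.mono_neutral_cong_left) (use fin in auto)
      ultimately show ?thesis by (simp add: sum.distrib distrib_right)
    qed
    with fin show "(\<lambda>x. g x + h x) \<in> S" by (auto simp: S_def)
  next
    fix g and k :: complex assume "g \<in> S"
    then obtain A c where "finite A" and g: "g = (\<lambda>x. \<Sum>n\<in>A. c n * \<phi> x powi n)" by (auto simp: S_def)
    then have "(\<lambda>x. k * g x) = (\<lambda>x. \<Sum>n\<in>A. (k * c n) * \<phi> x powi n)"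
      by (simp add: sum_distrib_left mult.assoc)
    with \<open>finite A\<close> show "(\<lambda>x. k * g x) \<in> S"
      unfolding S_def by (intro CollectI exI[of _ A] exI[of _ "\<lambda>n. k * c n"] conjI)
  qed
  have "(\<lambda>x. complex_of_real (g (\<phi> x))) \<in> L2_closure"
    if g: "continuous_on UNIV g" "range g \<subseteq> {0..1}" for g :: "complex \<Rightarrow> real"
  proof (rule closure_approx)
    have [measurable]: "g \<in> borel_measurable borel"
      by (rule borel_measurable_continuous_onI[OF g(1)])
    show sqg: "square_integrable M (\<lambda>x. complex_of_real (g (\<phi> x)))"
      using g(2) by (intro square_integrable_bounded[where B = 1]) (auto simp: image_subset_iff)
    fix \<epsilon> :: real assume e: "\<epsilon> > 0"
    \<comment> \<open>A uniform error \<delta> costs at most \<delta>^2 times the total mass; the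
      added 1 makes this strictly less than \<epsilon> and covers total mass 0.\<close>
    define \<delta> where "\<delta> = sqrt (\<epsilon> / (measure M (space M) + 1))"
    have pos: "measure M (space M) + 1 > 0" by (simp add: add_nonneg_pos)
    then have d: "\<delta> > 0" "\<delta>\<^sup>2 = \<epsilon> / (measure M (space M) + 1)" using e by (auto simp: \<delta>_def)
    obtain A c where A: "finite A"
      and close: "\<And>z. cmod z = 1 \<Longrightarrow> cmod (complex_of_real (g z) - (\<Sum>n\<in>A. c n * z powi n)) < \<delta>"
      using continuous_circle_approx_powers[OF continuous_on_subset[OF g(1) subset_UNIV] d(1)] by blast
    let ?h = "\<lambda>x. \<Sum>n\<in>A. c n * \<phi> x powi n"
    have h: "?h \<in> S" using A by (auto simp: S_def)
    have "integrable M (\<lambda>x. (cmod (complex_of_real (g (\<phi> x)) - ?h x))\<^sup>2)"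
      using square_integrable_diff[OF sqg square_integrable[OF h]] by (simp add: square_integrable_def)
    then have "(LINT x|M. (cmod (complex_of_real (g (\<phi> x)) - ?h x))\<^sup>2) \<le> (LINT x|M. \<delta>\<^sup>2)"
      by (rule integral_mono) (simp, rule power_mono[OF less_imp_le[OF close[OF circle]]], simp_all)
    also have "\<dots> = \<epsilon> * (measure M (space M) / (measure M (space M) + 1))"
      by (simp add: d(2))
    also have "\<dots> < \<epsilon> * 1"
      using e pos by (intro mult_strict_left_mono) auto
    finally show "\<exists>h\<in>L2_closure. (LINT x|M. (cmod (complex_of_real (g (\<phi> x)) - h x))\<^sup>2) < \<epsilon>"
      using subset_closure[OF h] by auto
  qed
  from closure_borel_composition[OF \<phi> this F sq]
  have "\<exists>g\<in>S. (LINT x|M. (cmod (F (\<phi> x) - g x))\<^sup>2) < \<epsilon>"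
    using \<open>\<epsilon> > 0\<close> by (simp add: L2_closure_def)
  then show ?thesis by (auto simp: S_def)
qed

text \<open>The interval is wound once around the circle by \<phi>. On the open interval this is
  injective with Borel inverse \<rho>, so every function of \<open>t\<close> is almost everywhere a
  function of \<phi> t. The shift \<open>r\<close> only changes the coefficients by unimodular
  factors.\<close>

lemma interval_exponentials_total:
  fixes M :: "real measure"
  assumes M: "finite_measure M" and sets: "sets M = sets borel"
    and supp: "AE t in M. a < t \<and> t < a + T" and T: "T > 0"
    and f: "square_integrable M f" and "\<epsilon> > 0"
  shows "\<exists>A c. finite A \<and>
    (LINT t|M. (cmod (f t - (\<Sum>n\<in>A. c n * cis (2 * pi * of_int n * (t + r) / T))))\<^sup>2) < \<epsilon>"
proof -
  note [measurable_cong] = sets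
  \<comment> \<open>Measuring angles from the midpoint keeps them strictly between -\<pi> and \<pi>,
    where the principal logarithm recovers them.\<close>
  define m where "m = a + T / 2"
  define \<phi> where "\<phi> t = cis (2 * pi * (t - m) / T)" for t
  \<comment> \<open>The logarithm is replaced by 0 on its branch cut, which makes \<rho> Borel on
    the whole plane; the open interval never reaches the cut.\<close>
  define \<rho> where "\<rho> z = m + T / (2 * pi) * Im (indicator (- \<real>\<^sub>\<le>\<^sub>0) z *\<^sub>R Ln z)" for z
  have \<phi>': "\<phi> \<in> borel_measurable borel"
    unfolding \<phi>_def by (intro borel_measurable_continuous_onI continuous_intros) (use T in auto)
  then have \<phi>: "\<phi> \<in> borel_measurable M" by (simp add: measurable_cong_sets[OF sets refl])
  have [measurable]: "(\<lambda>z. indicator (- \<real>\<^sub>\<le>\<^sub>0) z *\<^sub>R Ln z) \<in> borel_measurable borel"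
    by (intro borel_measurable_continuous_on_indicator continuous_on_Ln) auto
  have \<rho>[measurable]: "\<rho> \<in> borel_measurable borel"
    unfolding \<rho>_def by measurable
  have inv: "\<rho> (\<phi> t) = t" if t: "a < t" "t < a + T" for t
  proof -
    define \<theta> where "\<theta> = 2 * pi * (t - m) / T"
    have "\<bar>t - m\<bar> < T / 2" using t unfolding m_def by linarith
    then have "2 * \<bar>t - m\<bar> / T < 1" using T by simp
    then have "pi * (2 * \<bar>t - m\<bar> / T) < pi * 1" by (rule mult_strict_left_mono) simp
    moreover have "\<bar>\<theta>\<bar> = pi * (2 * \<bar>t - m\<bar> / T)" using T by (simp add: \<theta>_def abs_mult)
    ultimately have "\<bar>\<theta>\<bar> < pi" by simp
    then have \<theta>: "- pi < \<theta>" "\<theta> < pi" by auto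
    then have Ln: "Ln (cis \<theta>) = \<i> * \<theta>"
      unfolding cis_conv_exp by (subst Ln_exp) auto
    have "cis \<theta> \<notin> \<real>\<^sub>\<le>\<^sub>0"
    proof
      assume "cis \<theta> \<in> \<real>\<^sub>\<le>\<^sub>0"
      then have "cos \<theta> \<le> 0" "sin \<theta> = 0" by (auto simp: complex_nonpos_Reals_iff)
      with sin_eq_0_pi[OF \<theta>] show False by simp
    qed
    then have "\<rho> (\<phi> t) = m + T / (2 * pi) * \<theta>"
      by (simp add: \<rho>_def \<phi>_def \<theta>_def[symmetric] Ln)
    then show ?thesis using T by (simp add: \<theta>_def)
  qed
  have [measurable]: "f \<in> borel_measurable borel"
    using f by (simp add: square_integrable_def measurable_cong_sets[OF sets refl])
  have eq: "AE t in M. f (\<rho> (\<phi> t)) = f t"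
    using supp by eventually_elim (simp add: inv)
  have "integrable M (\<lambda>t. (cmod (f (\<rho> (\<phi> t))))\<^sup>2) \<longleftrightarrow> integrable M (\<lambda>t. (cmod (f t))\<^sup>2)"
    using \<phi> by (intro integrable_cong_AE) (auto intro: eventually_mono[OF eq])
  with f \<phi> have "square_integrable M (\<lambda>t. f (\<rho> (\<phi> t)))"
    by (simp add: square_integrable_def)
  with \<open>\<epsilon> > 0\<close> obtain A c where A: "finite A"
    and le: "(LINT t|M. (cmod (f (\<rho> (\<phi> t)) - (\<Sum>n\<in>A. c n * \<phi> t powi n)))\<^sup>2) < \<epsilon>"
    using circle_powers_total[OF M \<phi>, of "\<lambda>z. f (\<rho> z)" \<epsilon>] by (auto simp: \<phi>_def)
  \<comment> \<open>The constant phase between the origins \<open>m\<close> and \<open>-r\<close> is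
    absorbed into the coefficients.\<close>
  define c' where "c' n = c n * cis (- (2 * pi * of_int n * (m + r) / T))" for n
  have pow: "c n * \<phi> t powi n = c' n * cis (2 * pi * of_int n * (t + r) / T)" for n t
  proof -
    have "\<phi> t powi n = cis (- (2 * pi * of_int n * (m + r) / T) + 2 * pi * of_int n * (t + r) / T)"
      unfolding \<phi>_def cis_power_int by (rule arg_cong[of _ _ cis]) (use T in \<open>simp add: field_simps\<close>)
    then show ?thesis by (simp add: c'_def cis_mult)
  qed
  have "(LINT t|M. (cmod (f (\<rho> (\<phi> t)) - (\<Sum>n\<in>A. c n * \<phi> t powi n)))\<^sup>2)
      = (LINT t|M. (cmod (f t - (\<Sum>n\<in>A. c n * \<phi> t powi n)))\<^sup>2)"
    using \<phi> by (intro integral_cong_AE) (auto intro: eventually_mono[OF eq])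
  with le have "(LINT t|M. (cmod (f t - (\<Sum>n\<in>A. c' n * cis (2 * pi * of_int n * (t + r) / T))))\<^sup>2) < \<epsilon>"
    unfolding pow by simp
  with A show ?thesis by blast
qed

section \<open>Orthogonality over a full period\<close>

lemma integral_cis_period:
  fixes k :: int
  assumes T: "T > 0"
  shows "(LINT t|lborel. indicator {a..a + T} t *\<^sub>R cis (2 * pi * of_int k * (t + r) / T))
    = (if k = 0 then of_real T else 0)"
proof (cases "k = 0")
  case True
  then show ?thesis using T by (simp add: scaleR_conv_of_real)
next
  case False
  define w where "w = 2 * pi * of_int k / T"
  have w: "w \<noteq> 0" using False T by (simp add: w_def)
  let ?F = "\<lambda>t. cis (w * (t + r)) / (\<i> * w)"
  have "(LINT t|lborel. indicator {a..a + T} t *\<^sub>R cis (w * (t + r))) = ?F (a + T) - ?F a"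
  proof (rule integral_FTC_atLeastAtMost)
    show "(?F has_vector_derivative cis (w * (t + r))) (at t within {a..a + T})" for t
    proof -
      have "((\<lambda>z. exp (\<i> * (w * (z + r))) / (\<i> * w)) has_field_derivative exp (\<i> * (w * (of_real t + r)))) (at (of_real t))"
        using w by (auto intro!: derivative_eq_intros simp: mult_ac)
      from has_vector_derivative_real_field[OF this] show ?thesis
        by (simp add: cis_conv_exp)
    qed
    show "continuous_on {a..a + T} (\<lambda>t. cis (w * (t + r)))" by (intro continuous_intros)
  qed (use T in simp)
  \<comment> \<open>Over one period the argument grows by a multiple of 2 \<pi>, so the
    antiderivative takes equal values at both ends.\<close>
  also have "w * (a + T + r) = w * (a + r) + 2 * pi * of_int k"
    using T by (simp add: w_def field_simps)
  then have "cis (w * (a + T + r)) = cis (w * (a + r))"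
    by (simp add: cis_mult[symmetric] cis_multiple_2pi)
  then have "?F (a + T) - ?F a = 0" by simp
  finally show ?thesis using False by (simp add: w_def)
qed

section \<open>The spectrum for equal weights\<close>

lemma equal_weights_imp_spectral:
  assumes h: "h1 \<noteq> h2" and T: "T1 > 0" "T2 > 0"
    and c: "c = 1 / (T1 + T2)"
    and prob: "prob_space (two_segments a1 T1 c h1 a2 T2 c h2)"
  shows "spectral_measure (two_segments a1 T1 c h1 a2 T2 c h2)"
proof -
  let ?\<mu> = "two_segments a1 T1 c h1 a2 T2 c h2"
  interpret prob_space ?\<mu> by fact
  define T where "T = T1 + T2"
  have T0: "T > 0" using T by (simp add: T_def)
  have c0: "c > 0" "c = 1 / T" using T by (auto simp: c T_def)
  define s where "s = a1 + T1 - a2"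
  \<comment> \<open>The vertical coordinate \<open>h1\<close> contributes this shift on the first
    segment; on the second, \<open>h2\<close> contributes \<open>s + r\<close>, and the extra
    \<open>s\<close> undoes the slide.\<close>
  define r where "r = h1 * s / (h2 - h1)"
  define \<psi> where "\<psi> = fold_line (a1 + T1) s h1 h2"
  define M where "M = density lborel (\<lambda>t. ennreal (unfold_density a1 (a1 + T1) (a1 + T) c c t))"
  have \<psi>[measurable]: "\<psi> \<in> borel_measurable borel" by (simp add: \<psi>_def)
  have \<mu>: "?\<mu> = distr M borel \<psi>"
    using two_segments_eq_distr[of c c a1 T1 h1 a2 T2 h2] c0(1)
    by (simp add: M_def \<psi>_def s_def T_def add.assoc)
  have setsM: "sets M = sets borel" by (simp add: M_def)
  have \<psi>M: "\<psi> \<in> measurable M borel" by (simp add: measurable_cong_sets[OF setsM refl])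
  have "prob_space M" using prob_space_distrD[OF \<psi>M] prob by (simp add: \<mu>)
  then interpret M: prob_space M .
  have density: "unfold_density a1 (a1 + T1) (a1 + T) c c t = c * indicator {a1..a1 + T} t" for t
    using T by (auto simp: unfold_density_def T_def indicator_def)
  \<comment> \<open>Each frequency is orthogonal to (-s, h2 - h1), the jump of \<psi> between the
    two segments. The wave along the unfolded line therefore continues across the junction with the
    same phase.\<close>
  define \<Lambda> where "\<Lambda> n = (of_int n / T, of_int n * s / (T * (h2 - h1)))" for n :: int
  have inj: "inj \<Lambda>" using T0 by (auto simp: inj_def \<Lambda>_def)
  have wave: "exponential (\<Lambda> n) (\<psi> t) = cis (2 * pi * of_int n * (t + r) / T)" for n t
  proof -
    have "h2 * s / (h2 - h1) = s + r" using h by (simp add: r_def field_simps)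
    then have "fst (\<psi> t) + snd (\<psi> t) * s / (h2 - h1) = t + r"
      by (auto simp: \<psi>_def fold_line_def r_def)
    moreover have "\<Lambda> n \<bullet> \<psi> t = of_int n / T * (fst (\<psi> t) + snd (\<psi> t) * s / (h2 - h1))"
      by (simp add: \<Lambda>_def inner_prod_def distrib_left)
    ultimately have "\<Lambda> n \<bullet> \<psi> t = of_int n / T * (t + r)" by simp
    then show ?thesis by (simp add: exponential_def cis_conv_exp mult_ac)
  qed
  have expo: "exponential \<xi> \<in> borel_measurable ?\<mu>" for \<xi>
    by (simp add: measurable_cong_sets[OF sets_two_segments refl])
  have orth: "L2_inner ?\<mu> (exponential (\<Lambda> n)) (exponential (\<Lambda> k)) = (if n = k then 1 else 0)" for n k
  proof -
    have "L2_inner ?\<mu> (exponential (\<Lambda> n)) (exponential (\<Lambda> k))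
        = (LINT t|lborel. unfold_density a1 (a1 + T1) (a1 + T) c c t *\<^sub>R
            (exponential (\<Lambda> n) (\<psi> t) * cnj (exponential (\<Lambda> k) (\<psi> t))))"
      unfolding L2_inner_def using c0(1)
      by (subst integral_two_segments) (auto simp: \<psi>_def s_def T_def add.assoc)
    also have "\<dots> = (LINT t|lborel. c *\<^sub>R (indicator {a1..a1 + T} t *\<^sub>R cis (2 * pi * of_int (n - k) * (t + r) / T)))"
    proof (intro Bochner_Integration.integral_cong refl)
      fix t
      have "exponential (\<Lambda> n) (\<psi> t) * cnj (exponential (\<Lambda> k) (\<psi> t))
          = cis (2 * pi * of_int n * (t + r) / T + - (2 * pi * of_int k * (t + r) / T))"
        by (simp only: wave cis_cnj cis_mult)
      also have "2 * pi * of_int n * (t + r) / T + - (2 * pi * of_int k * (t + r) / T)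
          = 2 * pi * of_int (n - k) * (t + r) / T"
        by (simp add: diff_divide_distrib[symmetric] algebra_simps)
      finally show "unfold_density a1 (a1 + T1) (a1 + T) c c t *\<^sub>R
            (exponential (\<Lambda> n) (\<psi> t) * cnj (exponential (\<Lambda> k) (\<psi> t)))
          = c *\<^sub>R (indicator {a1..a1 + T} t *\<^sub>R cis (2 * pi * of_int (n - k) * (t + r) / T))"
        by (simp add: density)
    qed
    also have "\<dots> = (if n = k then 1 else 0)"
      unfolding integral_scaleR_right integral_cis_period[OF T0] using T0 c0(2)
      by (simp add: scaleR_conv_of_real)
    finally show ?thesis .
  qed
  have dense: "\<exists>F d. finite F \<and> F \<subseteq> range \<Lambda> \<and> L2_norm ?\<mu> (\<lambda>x. f x - (\<Sum>\<xi>\<in>F. d \<xi> * exponential \<xi> x)) < \<epsilon>"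
    if f: "square_integrable ?\<mu> f" and e: "\<epsilon> > 0" for f \<epsilon>
  proof -
    have fm[measurable]: "f \<in> borel_measurable borel"
      using f by (simp add: square_integrable_def measurable_cong_sets[OF sets_two_segments refl])
    have sq: "square_integrable M (\<lambda>t. f (\<psi> t))"
      using f \<psi>M unfolding \<mu> square_integrable_def by (simp add: integrable_distr_eq)
    \<comment> \<open>The two endpoints are null; they have to be excluded because winding around
      the circle identifies them.\<close>
    have supp: "AE t in M. a1 < t \<and> t < a1 + T"
      unfolding M_def density using AE_lborel_singleton[of a1] AE_lborel_singleton[of "a1 + T"]
      by (subst AE_density) (auto elim!: eventually_elim2 split: split_indicator)
    obtain A d where A: "finite A"
      and close: "(LINT t|M. (cmod (f (\<psi> t) - (\<Sum>n\<in>A. d n * cis (2 * pi * of_int n * (t + r) / T))))\<^sup>2) < \<epsilon>\<^sup>2"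
      using interval_exponentials_total[OF M.finite_measure_axioms setsM supp T0 sq, of "\<epsilon>\<^sup>2" r] e by auto
    \<comment> \<open>A spectrum is indexed by the frequencies themselves, so the integer-indexed
      coefficients are relabelled along the injective \<Lambda>.\<close>
    let ?d = "\<lambda>\<xi>. d (inv \<Lambda> \<xi>)"
    have sum: "(\<Sum>\<xi>\<in>\<Lambda> ` A. ?d \<xi> * exponential \<xi> x) = (\<Sum>n\<in>A. d n * exponential (\<Lambda> n) x)" for x
      using inj by (subst sum.reindex) (auto intro: inj_on_subset simp: inv_f_f)
    have "(LINT x|?\<mu>. (cmod (f x - (\<Sum>\<xi>\<in>\<Lambda> ` A. ?d \<xi> * exponential \<xi> x)))\<^sup>2)
        = (LINT t|M. (cmod (f (\<psi> t) - (\<Sum>n\<in>A. d n * cis (2 * pi * of_int n * (t + r) / T))))\<^sup>2)"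
      unfolding \<mu> sum by (subst integral_distr[OF \<psi>M]) (auto simp: wave)
    then have "L2_norm ?\<mu> (\<lambda>x. f x - (\<Sum>\<xi>\<in>\<Lambda> ` A. ?d \<xi> * exponential \<xi> x)) < sqrt (\<epsilon>\<^sup>2)"
      using close unfolding L2_norm_def by (intro real_sqrt_less_mono) simp
    with A e show ?thesis by (intro exI[of _ "\<Lambda> ` A"] exI[of _ ?d]) auto
  qed
  have "square_integrable ?\<mu> (exponential \<xi>)" for \<xi>
    by (rule square_integrable_bounded[OF expo, where B = 1]) simp
  with dense orth inj have "L2_orthonormal_basis ?\<mu> (range \<Lambda>) exponential"
    unfolding L2_orthonormal_basis_def by (auto simp: inj_eq)
  moreover have "countable (range \<Lambda>)" by simp
  ultimately show ?thesis
    using prob unfolding spectral_measure_def is_spectrum_def by (auto simp: sets_two_segments intro!: exI[of _ "range \<Lambda>"])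
qed

theorem theorem3:
  fixes h1 h2 a1 a2 T1 T2 c1 c2 :: real
    and \<mu> :: "(real \<times> real) measure"
  assumes "h1 \<noteq> h2"
    and "T1 > 0" and "T2 > 0" and "c1 > 0" and "c2 > 0"
    and "\<mu> = add_measure
      (scale_measure (ennreal c1) (lebesgue_restr {a1..a1 + T1} \<Otimes>\<^sub>M return borel h1))
      (scale_measure (ennreal c2) (lebesgue_restr {a2..a2 + T2} \<Otimes>\<^sub>M return borel h2))"
    and "prob_space \<mu>"
  shows "spectral_measure \<mu> \<longleftrightarrow> c1 = c2 \<and> c2 = 1 / (T1 + T2)"
proof -
  have \<mu>: "\<mu> = two_segments a1 T1 c1 h1 a2 T2 c2 h2"
    using assms(6) by (simp add: two_segments_def)
  \<comment> \<open>Total mass 1 turns equality of the weights into their value.\<close>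
  have mass: "c1 * T1 + c2 * T2 = 1"
    using two_segments_total_mass[of c1 c2 T1 T2 a1 h1 a2 h2] assms(2-5,7) unfolding \<mu> by linarith
  show ?thesis
  proof
    assume "spectral_measure \<mu>"
    then have "c1 = c2"
      unfolding \<mu> by (rule spectral_imp_equal_weights[OF assms(1-5)])
    with mass assms(2,3) show "c1 = c2 \<and> c2 = 1 / (T1 + T2)" by (simp add: field_simps)
  next
    assume "c1 = c2 \<and> c2 = 1 / (T1 + T2)"
    with assms(1-3,7) show "spectral_measure \<mu>"
      unfolding \<mu> by (metis equal_weights_imp_spectral)
  qed
qed

end
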